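(* Let $Z\sim MHT(k,\lambda_1,\dots,\lambda_n)$, where $n\ge2$, $k>0$ and $\lambda_1,\dots,\lambda_n>0$ are pairwise distinct. Then the cumulative distribution function of $Z$ is $$F_Z(t)=\sum_{i=1}^n\frac{1}{PT_i}F_{Y_i}(t)=\sum_{i=1}^n\frac{1-\left(\frac{\lambda_i}{t}\right)^{k}}{\prod_{j=1,\,j\neq i}^n\left(1-\frac{\lambda_i}{\lambda_j}\right)},$$ where $Y_i\sim\mathrm{Pareto}(k,\lambda_i)$ and $PT_i=\prod_{j=1,\,j\ne i}^n\left(1-\frac{\lambda_i}{\lambda_j}\right)$.
   Context: $\mathrm{Pareto}(k,\lambda)$ is defined as the Pareto distribution of the first kind with shape parameter $k>0$ and scale parameter $\lambda>0$, with PDF $f(t)=\frac{k\lambda^k}{t^{k+1}}$ and cumulative distribution function $F(t)=1-\left(\frac{\lambda}{t}\right)^k$. The Mixed Hypoexponential Pareto distribution $MHT(k,\lambda_1,\dots,\lambda_n)$ is the distribution with PDF $f_Z(t)=\sum_{i=1}^n\frac{1}{PT_i}f_{Y_i}(t)$, where $Y_i\sim\mathrm{Pareto}(k,\lambda_i)$. $F_X$ denotes the cumulative distribution function of $X$.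
   Formalization: The printed closed form is false for some t below the largest λ_i; it is proved for t ≥ all λ_i, and for every t with terms having t < λ_i set to 0. As f_Z can be negative (so no Z exists), the formula is also proved for the integral of f_Z over (-∞,t]. *)

theory Defs
  imports "HOL-Probability.Probability"
begin

text \<open>
  The Pareto law of the first kind with shape \<open>k\<close> and scale \<open>l\<close> lives on \<open>[l, \<infinity>)\<close>;
  the formula for the density is its value on that support, and the density vanishes off it.
\<close>

definition pareto_pdf :: "real \<Rightarrow> real \<Rightarrow> real \<Rightarrow> real" where
  "pareto_pdf k l t = (if l \<le> t then k * l powr k / t powr (k + 1) else 0)"

definition pareto_distributed :: "'a measure \<Rightarrow> ('a \<Rightarrow> real) \<Rightarrow> real \<Rightarrow> real \<Rightarrow> bool" where
  "pareto_distributed M Y k l \<longleftrightarrow>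
     prob_space M \<and> distributed M lborel Y (\<lambda>t. ennreal (pareto_pdf k l t))"

definition PT :: "nat \<Rightarrow> (nat \<Rightarrow> real) \<Rightarrow> nat \<Rightarrow> real" where
  "PT n l i = (\<Prod>j\<in>{1..n} - {i}. 1 - l i / l j)"

definition mht_pdf :: "nat \<Rightarrow> real \<Rightarrow> (nat \<Rightarrow> real) \<Rightarrow> real \<Rightarrow> real" where
  "mht_pdf n k l t = (\<Sum>i=1..n. 1 / PT n l i * pareto_pdf k (l i) t)"

text \<open>
  The weights \<open>1 / PT n l i\<close> sum to 1 but have mixed signs, so \<open>mht_pdf n k l\<close> has integral 1
  and need not be nonnegative. The truncation of negative values by \<^const>\<open>ennreal\<close> admits no
  spurious random variables: if \<open>mht_pdf n k l\<close> is negative on a set of positive measure,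
  its positive part has integral greater than 1 and is the density of no random variable
  on a probability space.
\<close>

definition mht_distributed ::
  "'a measure \<Rightarrow> ('a \<Rightarrow> real) \<Rightarrow> nat \<Rightarrow> real \<Rightarrow> (nat \<Rightarrow> real) \<Rightarrow> bool" where
  "mht_distributed M Z n k l \<longleftrightarrow>
     prob_space M \<and> distributed M lborel Z (\<lambda>t. ennreal (mht_pdf n k l t))"

end

theory Submission
  imports Defs
begin

text \<open>
  By linearity, integrating the mixed density over \<open>{..t}\<close> gives the mixture of the Pareto
  distribution functions, whose closed form is an elementary antiderivative. To identify the
  distribution function of \<open>Z\<close>, whose density is only known to be the positive part of the
  mixed density: the weights \<open>1 / PT n l i\<close> are the values at 0 of the Lagrange basis polynomials
  with nodes \<open>l 1, \<dots>, l n\<close>, so they sum to 1. Hence the mixed density and its positive part both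
  have integral 1, and they agree almost everywhere.
\<close>

text \<open>Interpolating the constant 1 at the nodes \<open>l i\<close> returns that constant, so
  the Lagrange basis polynomials \<open>B i\<close> sum to 1; evaluation at 0 then gives the
  weights. Distinct nodes make \<open>B i\<close> well defined, and nonzero nodes give the quotients
  \<open>l i / l j\<close> their meaning.\<close>

lemma lagrange_weights_sum_one:
  fixes l :: "'i \<Rightarrow> 'a :: field"
  assumes fin: "finite I" and ne: "I \<noteq> {}" and inj: "inj_on l I" and nz: "\<And>i. i \<in> I \<Longrightarrow> l i \<noteq> 0"
  shows "(\<Sum>i\<in>I. 1 / (\<Prod>j\<in>I - {i}. 1 - l i / l j)) = 1"
proof -
  define B where "B i = smult (1 / (\<Prod>j\<in>I - {i}. l i - l j)) (\<Prod>j\<in>I - {i}. [:- l j, 1:])" for i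
  have denom: "(\<Prod>j\<in>I - {i}. l i - l j) \<noteq> 0" if "i \<in> I" for i
    using that inj fin by (auto simp: inj_on_eq_iff)
  have node: "poly (B i) (l m) = (if i = m then 1 else 0)" if "i \<in> I" "m \<in> I" for i m
    using that denom[of i] fin by (auto simp: B_def poly_prod)
  have deg: "degree (B i) < card I" if "i \<in> I" for i
  proof -
    have "degree (B i) \<le> (\<Sum>j\<in>I - {i}. degree [:- l j, 1:])"
      unfolding B_def using degree_prod_sum_le[of "I - {i}" "\<lambda>j. [:- l j, 1:]"] fin
      by (auto intro: order.trans[OF degree_smult_le])
    also have "\<dots> < card I"
      using that fin card_Diff1_less[of I i] by simp
    finally show ?thesis .
  qed
  \<comment> \<open>Both sides have degree below \<open>card I\<close> and agree at the
    \<open>card I\<close> nodes.\<close>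
  have "(\<Sum>i\<in>I. B i) = 1"
  proof (rule poly_eqI_degree)
    show "poly (\<Sum>i\<in>I. B i) x = poly 1 x" if "x \<in> l ` I" for x
      using that fin by (auto simp: poly_sum node sum.delta')
    have card: "card (l ` I) = card I" using inj by (rule card_image)
    show "degree (\<Sum>i\<in>I. B i) < card (l ` I)"
      unfolding card using fin ne deg by (intro degree_sum_less) (auto simp: card_gt_0_iff)
    show "degree (1 :: 'a poly) < card (l ` I)"
      unfolding card using fin ne by (simp add: card_gt_0_iff)
  qed
  then have "(\<Sum>i\<in>I. poly (B i) 0) = 1"
    by (metis poly_1 poly_sum)
  moreover have "poly (B i) 0 = 1 / (\<Prod>j\<in>I - {i}. 1 - l i / l j)" if "i \<in> I" for i
  proof -
    \<comment> \<open>Extracting \<open>- l j\<close> from each factor splits the weight into the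
      normalising constant of \<open>B i\<close> and the value at 0 of its monic part.\<close>
    have "1 - l i / l j = (l i - l j) / (- l j)" if "j \<in> I" for j
      using nz[OF that] by (simp add: field_simps)
    then have "(\<Prod>j\<in>I - {i}. 1 - l i / l j) = (\<Prod>j\<in>I - {i}. l i - l j) / (\<Prod>j\<in>I - {i}. - l j)"
      by (simp flip: prod_dividef)
    then show ?thesis by (simp add: B_def poly_prod)
  qed
  ultimately show ?thesis by simp
qed

text \<open>Where \<open>f\<close> is nonnegative, \<open>ennreal\<close> truncates nothing, so the
  measure of a half-line becomes a Bochner integral. Nonnegativity is asked only almost everywhere
  because that is all that can be derived for the mixed density.\<close>

lemma cdf_eq_set_integral_density:
  assumes X: "distributed M lborel X (\<lambda>x. ennreal (f x))"
    and [measurable]: "f \<in> borel_measurable borel" and nn: "AE x in lborel. 0 \<le> f x"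
  shows "cdf (distr M borel X) t = (LINT x:{..t}|lborel. f x)"
proof -
  have meas: "X \<in> borel_measurable M"
    using distributed_measurable[OF X] by simp
  have "emeasure M (X -` {..t} \<inter> space M) = (\<integral>\<^sup>+ x. ennreal (f x) * indicator {..t} x \<partial>lborel)"
    by (rule distributed_emeasure[OF X]) simp
  also have "\<dots> = (\<integral>\<^sup>+ x. ennreal (indicator {..t} x * f x) \<partial>lborel)"
    by (intro nn_integral_cong) (auto simp: indicator_def)
  finally have "measure M (X -` {..t} \<inter> space M)
      = enn2real (\<integral>\<^sup>+ x. ennreal (indicator {..t} x * f x) \<partial>lborel)"
    by (simp add: measure_def)
  also have "\<dots> = (LINT x:{..t}|lborel. f x)"
    unfolding set_lebesgue_integral_def real_scaleR_def using nn
    by (intro integral_eq_nn_integral[symmetric]) (auto elim!: eventually_mono)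
  finally show ?thesis
    using meas by (simp add: cdf_def measure_distr)
qed

lemma nn_integral_density_eq_1:
  assumes "prob_space M" and X: "distributed M lborel X f"
  shows "(\<integral>\<^sup>+ x. f x \<partial>lborel) = 1"
proof -
  have "(\<integral>\<^sup>+ x. f x \<partial>lborel) = (\<integral>\<^sup>+ x. f x * indicator UNIV x \<partial>lborel)" by simp
  also have "\<dots> = emeasure M (X -` UNIV \<inter> space M)"
    by (rule distributed_emeasure[OF X, symmetric]) simp
  finally show ?thesis
    using prob_space.emeasure_space_1[OF \<open>prob_space M\<close>] by simp
qed

lemma pareto_pdf_measurable [measurable]: "pareto_pdf k l \<in> borel_measurable borel"
  unfolding pareto_pdf_def[abs_def] by measurable

lemma pareto_pdf_nonneg: "0 < k \<Longrightarrow> 0 \<le> pareto_pdf k l t"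
  by (simp add: pareto_pdf_def)

text \<open>The total mass is read off from the existence of \<open>Y\<close>, which avoids
  computing an improper integral.\<close>

lemma pareto_distributed_has_integral_1:
  assumes "pareto_distributed M Y k l" "0 < k"
  shows "has_bochner_integral lborel (pareto_pdf k l) 1"
  using assms nn_integral_density_eq_1[of M Y]
  by (intro has_bochner_integral_nn_integral)
    (auto simp: pareto_distributed_def pareto_pdf_nonneg)

lemma set_integral_pareto_pdf:
  assumes "0 < k" "0 < l"
  shows "(LINT x:{..t}|lborel. pareto_pdf k l x) = (if l \<le> t then 1 - (l / t) powr k else 0)"
proof (cases "l \<le> t")
  case True
  \<comment> \<open>Since the density vanishes below \<open>l\<close>, the range shrinks to a
    compact interval away from the singularity at 0. The left endpoint contributes the 1 of the
    closed form.\<close>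
  have "has_bochner_integral lborel (\<lambda>x. (k * l powr k / x powr (k + 1)) * indicator {l..t} x)
    (- ((l / t) powr k) - - ((l / l) powr k))"
  proof (rule has_bochner_integral_FTC_Icc_nonneg[where F = "\<lambda>x. - ((l / x) powr k)"])
    fix x assume "x \<in> {l..t}"
    then have "0 < x" using assms by simp
    then show "((\<lambda>x. - ((l / x) powr k)) has_real_derivative k * l powr k / x powr (k + 1)) (at x)"
      using assms
      by (auto intro!: derivative_eq_intros
          simp: powr_divide powr_add powr_diff field_simps power2_eq_square)
  qed (use True assms in auto)
  moreover have "(k * l powr k / x powr (k + 1)) * indicator {l..t} x
      = indicator {..t} x * pareto_pdf k l x" for x
    by (auto simp: pareto_pdf_def indicator_def)
  ultimately show ?thesis
    using True assms by (simp add: set_lebesgue_integral_def has_bochner_integral_integral_eq)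
next
  case False
  then have "(\<lambda>x. indicator {..t} x * pareto_pdf k l x) = (\<lambda>x. 0)"
    by (auto simp: pareto_pdf_def indicator_def)
  then show ?thesis using False by (simp add: set_lebesgue_integral_def)
qed

text \<open>The difference between the positive part and \<open>f\<close> is nonnegative with
  integral 0, hence zero almost everywhere.\<close>

lemma AE_nonneg_of_integral_max_0:
  fixes f :: "'a \<Rightarrow> real"
  assumes f: "integrable M f" and eq: "(\<integral>x. max 0 (f x) \<partial>M) = (\<integral>x. f x \<partial>M)"
  shows "AE x in M. 0 \<le> f x"
proof -
  have "integrable M (\<lambda>x. max 0 (f x) - f x)" "(\<integral>x. max 0 (f x) - f x \<partial>M) = 0"
    using f eq by simp_all
  then have "AE x in M. max 0 (f x) - f x = 0"
    by (subst (asm) integral_nonneg_eq_0_iff_AE) auto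
  then show ?thesis by (rule eventually_mono) simp
qed

text \<open>The first conjunct is conditional on some \<open>Z\<close> having the law; the second
  states the identity for the integrated density itself, whether or not such a \<open>Z\<close>
  exists. The last one takes \<open>t\<close> above all scales, where every Pareto distribution
  function is given by its power formula.\<close>

theorem corollary4:
  fixes n :: nat and k :: real and l :: "nat \<Rightarrow> real"
    and M :: "'a measure" and Z :: "'a \<Rightarrow> real"
    and N :: "nat \<Rightarrow> 'b measure" and Y :: "nat \<Rightarrow> 'b \<Rightarrow> real"
  assumes "2 \<le> n" and "0 < k"
    and "\<forall>i\<in>{1..n}. 0 < l i" and "inj_on l {1..n}"
    and "\<forall>i\<in>{1..n}. pareto_distributed (N i) (Y i) k (l i)"
  shows
    "(mht_distributed M Z n k l \<longrightarrow>
       (\<forall>t. cdf (distr M borel Z) t = (\<Sum>i=1..n. 1 / PT n l i * cdf (distr (N i) borel (Y i)) t)))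
     \<and> (\<forall>t. set_integrable lborel {..t} (mht_pdf n k l) \<and>
           (LINT x:{..t}|lborel. mht_pdf n k l x)
             = (\<Sum>i=1..n. 1 / PT n l i * cdf (distr (N i) borel (Y i)) t))
     \<and> (\<forall>t. (\<Sum>i=1..n. 1 / PT n l i * cdf (distr (N i) borel (Y i)) t)
             = (\<Sum>i=1..n. (if l i \<le> t then 1 - (l i / t) powr k else 0)
                          / (\<Prod>j\<in>{1..n} - {i}. 1 - l i / l j)))
     \<and> (\<forall>t. (\<forall>i\<in>{1..n}. l i \<le> t) \<longrightarrow>
           (\<Sum>i=1..n. 1 / PT n l i * cdf (distr (N i) borel (Y i)) t)
             = (\<Sum>i=1..n. (1 - (l i / t) powr k) / (\<Prod>j\<in>{1..n} - {i}. 1 - l i / l j)))"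
proof -
  have prob: "pareto_distributed (N i) (Y i) k (l i)" "0 < l i" if "i \<in> {1..n}" for i
    using assms that by auto
  have int: "has_bochner_integral lborel (pareto_pdf k (l i)) 1" if "i \<in> {1..n}" for i
    using prob[OF that] \<open>0 < k\<close> by (auto intro: pareto_distributed_has_integral_1)
  have cdfY: "cdf (distr (N i) borel (Y i)) t = (LINT x:{..t}|lborel. pareto_pdf k (l i) x)"
    if "i \<in> {1..n}" for i t
    using prob[OF that] \<open>0 < k\<close>
    by (intro cdf_eq_set_integral_density) (auto simp: pareto_distributed_def pareto_pdf_nonneg)
  have "has_bochner_integral lborel (mht_pdf n k l) (\<Sum>i=1..n. 1 / PT n l i * 1)"
    unfolding mht_pdf_def[abs_def]
    by (intro has_bochner_integral_sum has_bochner_integral_mult_right int)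
  moreover have "(\<Sum>i=1..n. 1 / PT n l i) = 1"
    unfolding PT_def using assms by (intro lagrange_weights_sum_one) force+
  ultimately have mht: "has_bochner_integral lborel (mht_pdf n k l) 1"
    by simp
  have mht_int: "integrable lborel (mht_pdf n k l)"
    using mht by (simp add: has_bochner_integral_iff)
  have mht_set_int: "set_integrable lborel {..t} (mht_pdf n k l)" for t
    using mht_int unfolding set_integrable_def by (intro integrable_mult_indicator) auto
  have mixture: "(LINT x:{..t}|lborel. mht_pdf n k l x)
      = (\<Sum>i=1..n. 1 / PT n l i * cdf (distr (N i) borel (Y i)) t)" for t
  proof -
    have "integrable lborel (\<lambda>x. 1 / PT n l i * (indicator {..t} x * pareto_pdf k (l i) x))"
      if "i \<in> {1..n}" for i
      using int[OF that] integrable_mult_indicator[of "{..t}" lborel "pareto_pdf k (l i)"]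
      by (intro integrable_mult_right) (auto simp: has_bochner_integral_iff)
    then have "(LINT x|lborel. (\<Sum>i=1..n. 1 / PT n l i * (indicator {..t} x * pareto_pdf k (l i) x)))
        = (\<Sum>i=1..n. 1 / PT n l i * (LINT x:{..t}|lborel. pareto_pdf k (l i) x))"
      by (subst Bochner_Integration.integral_sum)
        (auto simp: set_lebesgue_integral_def)
    then show ?thesis
      by (simp add: set_lebesgue_integral_def mht_pdf_def sum_distrib_left mult.left_commute cdfY)
  qed
  have closed: "(\<Sum>i=1..n. 1 / PT n l i * cdf (distr (N i) borel (Y i)) t)
      = (\<Sum>i=1..n. (if l i \<le> t then 1 - (l i / t) powr k else 0)
                          / (\<Prod>j\<in>{1..n} - {i}. 1 - l i / l j))" for t
    using \<open>0 < k\<close> prob by (intro sum.cong) (auto simp: PT_def cdfY set_integral_pareto_pdf)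
  have cdfZ: "cdf (distr M borel Z) t = (LINT x:{..t}|lborel. mht_pdf n k l x)"
    if Z: "mht_distributed M Z n k l" for t
  proof (rule cdf_eq_set_integral_density)
    show dist: "distributed M lborel Z (\<lambda>x. ennreal (mht_pdf n k l x))"
      using Z by (simp add: mht_distributed_def)
    show meas: "mht_pdf n k l \<in> borel_measurable borel"
      using borel_measurable_integrable[OF mht_int] by simp
    \<comment> \<open>The law of \<open>Z\<close> only sees the truncated density, so this positive
      part has mass 1. The weights give the untruncated density integral 1 as well, which forces the
      two to agree almost everywhere.\<close>
    have "(\<integral>\<^sup>+ x. ennreal (max 0 (mht_pdf n k l x)) \<partial>lborel) = 1"
      using Z nn_integral_density_eq_1[OF _ dist] by (simp add: mht_distributed_def ennreal_max_0)
    then have "(\<integral>x. max 0 (mht_pdf n k l x) \<partial>lborel) = 1"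
      using meas by (subst integral_eq_nn_integral) auto
    then show "AE x in lborel. 0 \<le> mht_pdf n k l x"
      using mht by (intro AE_nonneg_of_integral_max_0) (auto simp: has_bochner_integral_iff)
  qed
  have "(\<Sum>i=1..n. 1 / PT n l i * cdf (distr (N i) borel (Y i)) t)
      = (\<Sum>i=1..n. (1 - (l i / t) powr k) / (\<Prod>j\<in>{1..n} - {i}. 1 - l i / l j))"
    if "\<forall>i\<in>{1..n}. l i \<le> t" for t
    unfolding closed using that by (intro sum.cong) auto
  then show ?thesis
    using cdfZ mht_set_int mixture closed by auto
qed

end
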